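(* Let $m\ge 2$, let $\mathcal{P}$ be an order-$m$, $n$-dimensional stochastic tensor, let $v$ and $x_0$ be stochastic vectors in $\mathbb{R}^n$, and let $0\le\alpha<1/(m-1)$. Let $R$ be the flattening of $\mathcal{P}$ along the first index and, for a stochastic vector $x$, let $S(x)$ be the $n\times n$ stochastic matrix $$S(x)=\frac{1}{m-1}\,R\sum_{l=1}^{m-1}\bigl(\underbrace{x\otimes\cdots\otimes x}_{l-1\text{ terms}}\otimes I\otimes\underbrace{x\otimes\cdots\otimes x}_{m-1-l\text{ terms}}\bigr).$$ The inverse multilinear PageRank iteration $$x_{k+1}=\alpha\,S(x_k)\,x_{k+1}+(1-\alpha)v$$ converges to the unique solution $x$ of the multilinear PageRank problem $(\alpha,\mathcal{P},v)$, and for all $k\ge 0$ $$\|x_k-x\|_1\le\left(\frac{(m-2)\alpha}{1-\alpha}\right)^k\|x_0-x\|_1\le 2\left(\frac{(m-2)\alpha}{1-\alpha}\right)^k .$$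
   Context: A vector is stochastic if its entries are nonnegative and sum to $1$; a matrix is (column) stochastic if each column is a stochastic vector. An order-$m$, $n$-dimensional tensor is an array with $m$ indices, each ranging over $1,\dots,n$; it is stochastic if its entries are nonnegative and, for every fixed choice of the last $m-1$ indices, the sum over the first index equals $1$. The flattening $R$ of $\mathcal{P}$ along the first index is the $n\times n^{m-1}$ matrix with $R(e_{i_m}\otimes\cdots\otimes e_{i_2})=\mathcal{P}(:,i_2,\dots,i_m)$, where $e_i$ are the standard basis vectors, $\otimes$ is the Kronecker product; $I$ is the $n\times n$ identity. A solution of the multilinear PageRank problem $(\alpha,\mathcal{P},v)$ is a stochastic vector $x$ with $x=\alpha R(x\otimes\cdots\otimes x)+(1-\alpha)v$ ($m-1$ factors); for $\alpha<1/(m-1)$ it exists and is unique. Convention: $0^0=1$. *)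

theory Defs
  imports Jordan_Normal_Form.Matrix Complex_Main
begin

text \<open>Indices run over \<open>0, \<dots>, n - 1\<close> instead of \<open>1, \<dots>, n\<close>.\<close>

definition stochastic_vec :: "nat \<Rightarrow> real vec \<Rightarrow> bool" where
  "stochastic_vec n x \<longleftrightarrow> x \<in> carrier_vec n \<and> (\<forall>i<n. 0 \<le> x $ i) \<and> (\<Sum>i<n. x $ i) = 1"

definition stochastic_mat :: "nat \<Rightarrow> nat \<Rightarrow> real mat \<Rightarrow> bool" where
  "stochastic_mat nr nc A \<longleftrightarrow> A \<in> carrier_mat nr nc \<and> (\<forall>j<nc. stochastic_vec nr (col A j))"

text \<open>A tensor of order \<open>m\<close> and dimension \<open>n\<close> is a function on index lists; only its values on
  lists of length \<open>m\<close> with entries below \<open>n\<close> matter.\<close>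

definition stochastic_tensor :: "nat \<Rightarrow> nat \<Rightarrow> (nat list \<Rightarrow> real) \<Rightarrow> bool" where
  "stochastic_tensor m n P \<longleftrightarrow>
     (\<forall>is. length is = m \<and> set is \<subseteq> {..<n} \<longrightarrow> 0 \<le> P is) \<and>
     (\<forall>js. length js = m - 1 \<and> set js \<subseteq> {..<n} \<longrightarrow> (\<Sum>i<n. P (i # js)) = 1)"

definition kron :: "'a :: semiring_1 mat \<Rightarrow> 'a mat \<Rightarrow> 'a mat" where
  "kron A B = mat (dim_row A * dim_row B) (dim_col A * dim_col B)
     (\<lambda>(i, j). A $$ (i div dim_row B, j div dim_col B) * B $$ (i mod dim_row B, j mod dim_col B))"

definition kron_list :: "'a :: semiring_1 mat list \<Rightarrow> 'a mat" where
  "kron_list As = foldr kron As (1\<^sub>m 1)"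

abbreviation col_mat :: "'a vec \<Rightarrow> 'a mat" where
  "col_mat x \<equiv> mat_of_cols (dim_vec x) [x]"

text \<open>The last \<open>m - 1\<close> tensor indices \<open>i\<^sub>2, \<dots>, i\<^sub>m\<close> are the base-\<open>n\<close> digits of the column number,
  with \<open>i\<^sub>2\<close> the least significant one; see \<open>flattening_mult_unit_vecs\<close> below for the
  property that characterises the flattening.\<close>

definition flattening :: "nat \<Rightarrow> nat \<Rightarrow> (nat list \<Rightarrow> real) \<Rightarrow> real mat" where
  "flattening m n P = mat n (n ^ (m - 1))
     (\<lambda>(i, j). P (i # map (\<lambda>t. j div n ^ t mod n) [0..<m - 1]))"

definition S_mat :: "nat \<Rightarrow> nat \<Rightarrow> (nat list \<Rightarrow> real) \<Rightarrow> real vec \<Rightarrow> real mat" where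
  "S_mat m n P x = (1 / (real m - 1)) \<cdot>\<^sub>m (flattening m n P *
     finsum (module_mat TYPE(real) (n ^ (m - 1)) n)
       (\<lambda>l. kron_list (replicate (l - 1) (col_mat x) @ [1\<^sub>m n] @ replicate (m - 1 - l) (col_mat x)))
       {1..m - 1})"

definition multilinear_pagerank_solution ::
    "nat \<Rightarrow> nat \<Rightarrow> real \<Rightarrow> (nat list \<Rightarrow> real) \<Rightarrow> real vec \<Rightarrow> real vec \<Rightarrow> bool" where
  "multilinear_pagerank_solution m n \<alpha> P v x \<longleftrightarrow> stochastic_vec n x \<and>
     x = \<alpha> \<cdot>\<^sub>v (flattening m n P *\<^sub>v col (kron_list (replicate (m - 1) (col_mat x))) 0)
         + (1 - \<alpha>) \<cdot>\<^sub>v v"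

text \<open>Each step is a linear system for the next iterate. Neither its solvability nor stochasticity
  of the iterates is built into this predicate.\<close>

definition inverse_iteration :: "nat \<Rightarrow> nat \<Rightarrow> real \<Rightarrow> (nat list \<Rightarrow> real) \<Rightarrow> real vec \<Rightarrow> real vec
    \<Rightarrow> (nat \<Rightarrow> real vec) \<Rightarrow> bool" where
  "inverse_iteration m n \<alpha> P v x0 X \<longleftrightarrow> X 0 = x0 \<and> (\<forall>k. X k \<in> carrier_vec n) \<and>
     (\<forall>k. X (Suc k) = \<alpha> \<cdot>\<^sub>v (S_mat m n P (X k) *\<^sub>v X (Suc k)) + (1 - \<alpha>) \<cdot>\<^sub>v v)"

definition l1_norm :: "real vec \<Rightarrow> real" where
  "l1_norm x = (\<Sum>i<dim_vec x. \<bar>x $ i\<bar>)"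

definition vec_tendsto :: "nat \<Rightarrow> (nat \<Rightarrow> real vec) \<Rightarrow> real vec \<Rightarrow> bool" where
  "vec_tendsto n X x \<longleftrightarrow> (\<forall>i<n. (\<lambda>k. X k $ i) \<longlonglongrightarrow> x $ i)"

lemma kron_unit_vecs:
  assumes "i < n" "j < k"
  shows "kron (col_mat (unit_vec n i)) (col_mat (unit_vec k j))
    = (col_mat (unit_vec (n * k) (i * k + j)) :: 'a :: semiring_1 mat)"
proof (rule eq_matI)
  fix a b
  assume "a < dim_row (col_mat (unit_vec (n * k) (i * k + j) :: 'a vec))"
    and "b < dim_col (col_mat (unit_vec (n * k) (i * k + j) :: 'a vec))"
  then have a: "a < n * k" and b: "b = 0" by auto
  have k: "a mod k < k" and q: "a div k < n"
    using assms a by (auto simp: less_mult_imp_div_less)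
  have ij: "i * k + j < n * k"
  proof -
    have "i * k + j < Suc i * k" using assms by simp
    also have "\<dots> \<le> n * k" using assms by (intro mult_le_mono1) simp
    finally show ?thesis .
  qed
  have "a = i * k + j \<longleftrightarrow> a div k = i \<and> a mod k = j"
    using assms div_mult_mod_eq[of a k] by auto
  with assms a b k q ij
  show "kron (col_mat (unit_vec n i)) (col_mat (unit_vec k j)) $$ (a, b)
    = (col_mat (unit_vec (n * k) (i * k + j)) :: 'a mat) $$ (a, b)"
    by (auto simp: kron_def mat_of_cols_def)
qed (auto simp: kron_def)

lemma kron_list_unit_vecs:
  assumes "set js \<subseteq> {..<n}"
  shows "\<exists>j < n ^ length js. (\<forall>t < length js. j div n ^ t mod n = js ! t) \<and>
    kron_list (map (\<lambda>i. col_mat (unit_vec n i)) (rev js))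
      = (col_mat (unit_vec (n ^ length js) j) :: 'a :: semiring_1 mat)"
  using assms
proof (induction js rule: rev_induct)
  case Nil
  show ?case by (auto simp: kron_list_def mat_of_cols_def)
next
  case (snoc i js)
  let ?N = "n ^ length js"
  from snoc obtain j where j: "j < ?N" "\<forall>t < length js. j div n ^ t mod n = js ! t"
    "kron_list (map (\<lambda>i. col_mat (unit_vec n i)) (rev js))
      = (col_mat (unit_vec ?N j) :: 'a mat)" by auto
  from snoc.prems have i: "i < n" by simp
  have lt: "i * ?N + j < n * ?N"
  proof -
    have "i * ?N + j < Suc i * ?N" using j by simp
    also have "\<dots> \<le> n * ?N" using i by (intro mult_le_mono1) simp
    finally show ?thesis .
  qed
  have "(i * ?N + j) div n ^ t mod n = (js @ [i]) ! t" if t: "t < Suc (length js)" for t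
  proof (cases "t = length js")
    case True
    then show ?thesis using i j by simp
  next
    case False
    with t have tl: "t < length js" by simp
    then obtain d where d: "length js = Suc (t + d)" using less_imp_Suc_add by blast
    have "i * ?N + j = (i * n ^ d * n) * n ^ t + j"
      unfolding d by (simp add: power_add algebra_simps)
    then have "(i * ?N + j) div n ^ t = i * n ^ d * n + j div n ^ t"
      using i by (simp only: div_mult_self3) simp
    then show ?thesis using j tl by (simp add: nth_append)
  qed
  moreover have "kron_list (map (\<lambda>i. col_mat (unit_vec n i)) (rev (js @ [i])))
      = (col_mat (unit_vec (n * ?N) (i * ?N + j)) :: 'a mat)"
    using kron_unit_vecs[OF i j(1)] j(3) by (simp add: kron_list_def)
  ultimately show ?case using lt by (intro exI[of _ "i * ?N + j"]) simp
qed

lemma flattening_mult_unit_vecs: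
  assumes "length js = m - 1" "set js \<subseteq> {..<n}"
  shows "flattening m n P * kron_list (map (\<lambda>i. col_mat (unit_vec n i)) (rev js))
    = col_mat (vec n (\<lambda>i. P (i # js)))"
proof -
  from kron_list_unit_vecs[OF assms(2)] assms(1) obtain j where j: "j < n ^ (m - 1)"
    "\<forall>t < m - 1. j div n ^ t mod n = js ! t"
    "kron_list (map (\<lambda>i. col_mat (unit_vec n i)) (rev js))
      = (col_mat (unit_vec (n ^ (m - 1)) j) :: real mat)" by auto
  have js: "map (\<lambda>t. j div n ^ t mod n) [0..<m - 1] = js"
    using j(2) assms(1) by (intro nth_equalityI) auto
  have "col (col_mat (unit_vec (n ^ (m - 1)) j)) 0 = (unit_vec (n ^ (m - 1)) j :: real vec)"
    by (simp add: col_mat_of_cols)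
  then show ?thesis unfolding j(3)
    using j(1) js by (intro eq_matI) (auto simp: flattening_def mat_of_cols_def)
qed

end

theory Submission
  imports Defs
begin

text \<open>
  Everything is measured in the $1$-norm. A stochastic matrix has $1$-norm one, and stochastic
  matrices are closed under products, averages and Kronecker products. Hence a Kronecker product
  of stochastic vectors changes by at most the sum of the changes of its factors
  (\<open>col_dist_kron_list_le\<close>), and \<open>R\<close> does not enlarge this.

  Write \<open>p = m - 1\<close> and \<open>x\<^sup>p\<close> for the \<open>p\<close>-fold Kronecker power. Since all \<open>p\<close> factors of \<open>x\<^sup>p\<close>
  depend on \<open>x\<close>, the map \<open>x \<mapsto> \<alpha> R x\<^sup>p + (1 - \<alpha>) v\<close> is a contraction of the simplex with factor
  \<open>\<alpha> p < 1\<close>, and the problem has exactly one solution \<open>x\<close>. In \<open>S(y) x\<close>, on the other hand, \<open>x\<close>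
  already fills one slot of each Kronecker product, so only \<open>p - 1 = m - 2\<close> factors differ from
  those of \<open>x\<^sup>p\<close> and \<open>\<parallel>S(y) x - R x\<^sup>p\<parallel> \<le> (m - 2) \<parallel>y - x\<parallel>\<close> (\<open>S_mat_mult_flattening_le\<close>).

  Subtracting the equation of the solution from that of a step \<open>z = \<alpha> S(y) z + (1 - \<alpha>) v\<close> and
  inserting \<open>S(y) x\<close> gives \<open>\<parallel>z - x\<parallel> \<le> \<alpha> (\<parallel>z - x\<parallel> + (m - 2) \<parallel>y - x\<parallel>)\<close>. Solving for \<open>\<parallel>z - x\<parallel>\<close>
  yields the rate \<open>(m - 2) \<alpha> / (1 - \<alpha>)\<close> (\<open>inverse_step_error_le\<close>), which is below one exactly when
  \<open>(m - 1) \<alpha> < 1\<close>. The step itself is well defined because \<open>z \<mapsto> \<alpha> S(y) z + (1 - \<alpha>) v\<close> contracts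
  by \<open>\<alpha> < 1\<close> and preserves the simplex.
\<close>

section \<open>The $1$-norm\<close>

lemma l1_norm_nonneg: "0 \<le> l1_norm x"
  by (simp add: l1_norm_def sum_nonneg)

lemma l1_norm_diff:
  assumes "y \<in> carrier_vec n"
  shows "l1_norm (x - y) = (\<Sum>i<n. \<bar>x $ i - y $ i\<bar>)"
  using assms by (auto simp: l1_norm_def intro!: sum.cong)

lemma l1_norm_triangle:
  assumes "y \<in> carrier_vec n" "z \<in> carrier_vec n"
  shows "l1_norm (x - z) \<le> l1_norm (x - y) + l1_norm (y - z)"
  unfolding l1_norm_diff[OF assms(1)] l1_norm_diff[OF assms(2)] sum.distrib[symmetric]
  by (intro sum_mono) linarith

lemma l1_norm_diff_eq_0_iff:
  assumes "x \<in> carrier_vec n" "y \<in> carrier_vec n"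
  shows "l1_norm (x - y) = 0 \<longleftrightarrow> x = y"
  unfolding l1_norm_diff[OF assms(2)] using assms
  by (subst sum_nonneg_eq_0_iff) (auto intro!: eq_vecI)

lemma l1_norm_affine_diff:
  fixes \<alpha> :: real
  assumes "x \<in> carrier_vec n" "y \<in> carrier_vec n" "w \<in> carrier_vec n" "0 \<le> \<alpha>"
  shows "l1_norm ((\<alpha> \<cdot>\<^sub>v x + w) - (\<alpha> \<cdot>\<^sub>v y + w)) = \<alpha> * l1_norm (x - y)"
proof -
  have "\<bar>(\<alpha> \<cdot>\<^sub>v x + w) $ i - (\<alpha> \<cdot>\<^sub>v y + w) $ i\<bar> = \<alpha> * \<bar>x $ i - y $ i\<bar>" if "i < n" for i
    using that assms abs_mult[of \<alpha> "x $ i - y $ i"] by (simp add: right_diff_distrib)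
  moreover have "\<alpha> \<cdot>\<^sub>v y + w \<in> carrier_vec n" using assms by simp
  ultimately show ?thesis
    by (simp add: l1_norm_diff[OF assms(2)] l1_norm_diff sum_distrib_left)
qed

lemma stochastic_vec_carrier: "stochastic_vec n x \<Longrightarrow> x \<in> carrier_vec n"
  by (simp add: stochastic_vec_def)

lemma stochastic_vec_convex:
  assumes "stochastic_vec n x" "stochastic_vec n y" "0 \<le> \<alpha>" "\<alpha> \<le> 1"
  shows "stochastic_vec n (\<alpha> \<cdot>\<^sub>v x + (1 - \<alpha>) \<cdot>\<^sub>v y)"
  using assms by (auto simp: stochastic_vec_def sum.distrib sum_distrib_left[symmetric])

lemma l1_norm_stochastic_diff_le:
  assumes x: "stochastic_vec n x" and y: "stochastic_vec n y"
  shows "l1_norm (x - y) \<le> 2"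
proof -
  have "l1_norm (x - y) \<le> (\<Sum>i<n. x $ i + y $ i)"
    unfolding l1_norm_diff[OF stochastic_vec_carrier[OF y]]
    using x y by (intro sum_mono) (force simp: stochastic_vec_def abs_le_iff)
  also have "\<dots> = 2" using x y by (simp add: stochastic_vec_def sum.distrib)
  finally show ?thesis .
qed

section \<open>Fixed points of contractions of the simplex\<close>

text \<open>This is the existence half of Banach's theorem. Completeness is used coordinatewise: the
  increments of each coordinate along the orbit of \<open>u\<close> are dominated by a geometric series.\<close>

lemma stochastic_contraction_fixpoint:
  assumes u: "stochastic_vec n u" and "0 \<le> c" "c < 1"
    and maps: "\<And>x. stochastic_vec n x \<Longrightarrow> stochastic_vec n (f x)"
    and contr: "\<And>x y. stochastic_vec n x \<Longrightarrow> stochastic_vec n y \<Longrightarrow>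
      l1_norm (f x - f y) \<le> c * l1_norm (x - y)"
  shows "\<exists>x. stochastic_vec n x \<and> f x = x"
proof -
  define X where "X k = (f ^^ k) u" for k
  define D where "D = l1_norm (f u - u)"
  have X: "stochastic_vec n (X k)" for k
    by (induction k) (auto simp: X_def u maps)
  note Xc = stochastic_vec_carrier[OF X]
  have step: "l1_norm (X (Suc k) - X k) \<le> c ^ k * D" for k
  proof (induction k)
    case 0
    show ?case by (simp add: X_def D_def)
  next
    case (Suc k)
    have "l1_norm (X (Suc (Suc k)) - X (Suc k)) \<le> c * l1_norm (X (Suc k) - X k)"
      using contr[OF X X, of "Suc k" k] by (simp add: X_def)
    also have "\<dots> \<le> c * (c ^ k * D)" using Suc \<open>0 \<le> c\<close> by (rule mult_left_mono)
    finally show ?case by simp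
  qed
  \<comment> \<open>Each coordinate is a telescoping series dominated by a geometric one.\<close>
  have "\<exists>L. (\<lambda>k. X k $ i) \<longlonglongrightarrow> L" if i: "i < n" for i
  proof -
    have "\<bar>X (Suc k) $ i - X k $ i\<bar> \<le> c ^ k * D" for k
    proof -
      have "\<bar>X (Suc k) $ i - X k $ i\<bar> \<le> l1_norm (X (Suc k) - X k)"
        unfolding l1_norm_diff[OF Xc] using i
        by (intro member_le_sum[of i "{..<n}" "\<lambda>i. \<bar>X (Suc k) $ i - X k $ i\<bar>"]) auto
      with step[of k] show ?thesis by linarith
    qed
    then have "summable (\<lambda>k. X (Suc k) $ i - X k $ i)"
      using summable_mult2[OF summable_geometric[of c], of D] \<open>0 \<le> c\<close> \<open>c < 1\<close>
      by (auto intro: summable_comparison_test[of _ "\<lambda>k. c ^ k * D"])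
    then have "convergent (\<lambda>N. \<Sum>k<N. X (Suc k) $ i - X k $ i)"
      by (simp add: summable_iff_convergent)
    then obtain L where "(\<lambda>N. X N $ i - X 0 $ i) \<longlonglongrightarrow> L"
      using sum_lessThan_telescope[of "\<lambda>k. X k $ i"] by (auto simp: convergent_def)
    from tendsto_add[OF this tendsto_const[of "X 0 $ i"]] show ?thesis by auto
  qed
  then obtain L where L: "(\<lambda>k. X k $ i) \<longlonglongrightarrow> L i" if "i < n" for i by metis
  define x where "x = vec n L"
  have xc: "x \<in> carrier_vec n" by (simp add: x_def)
  have lim: "(\<lambda>k. X k $ i) \<longlonglongrightarrow> x $ i" if "i < n" for i
    using L that by (simp add: x_def)
  have x: "stochastic_vec n x"
    unfolding stochastic_vec_def
  proof (intro conjI allI impI)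
    fix i assume "i < n"
    then show "0 \<le> x $ i" using X
      by (intro LIMSEQ_le_const[OF lim]) (auto simp: stochastic_vec_def)
  next
    have "(\<lambda>k. \<Sum>i<n. X k $ i) \<longlonglongrightarrow> (\<Sum>i<n. x $ i)"
      by (intro tendsto_sum lim) simp
    moreover have "(\<Sum>i<n. X k $ i) = 1" for k using X[of k] by (simp add: stochastic_vec_def)
    ultimately show "(\<Sum>i<n. x $ i) = 1" by (simp add: LIMSEQ_const_iff)
  qed (rule xc)
  have dist: "(\<lambda>k. l1_norm (X k - x)) \<longlonglongrightarrow> 0"
  proof -
    have "(\<lambda>k. \<Sum>i<n. \<bar>X k $ i - x $ i\<bar>) \<longlonglongrightarrow> (\<Sum>i<n. \<bar>x $ i - x $ i\<bar>)"
      by (intro tendsto_intros lim) simp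
    then show ?thesis by (simp add: l1_norm_diff[OF xc])
  qed
  have fxc: "f x \<in> carrier_vec n" by (rule stochastic_vec_carrier[OF maps[OF x]])
  have "l1_norm (x - f x) \<le> l1_norm (X (Suc k) - x) + c * l1_norm (X k - x)" for k
  proof -
    have "l1_norm (x - f x) \<le> l1_norm (x - X (Suc k)) + l1_norm (X (Suc k) - f x)"
      by (rule l1_norm_triangle[OF Xc fxc])
    moreover have "l1_norm (x - X (Suc k)) = l1_norm (X (Suc k) - x)"
      by (simp add: l1_norm_diff[OF Xc] l1_norm_diff[OF xc] abs_minus_commute)
    moreover have "l1_norm (X (Suc k) - f x) \<le> c * l1_norm (X k - x)"
      using contr[OF X x, of k] by (simp add: X_def)
    ultimately show ?thesis by linarith
  qed
  moreover have "(\<lambda>k. l1_norm (X (Suc k) - x) + c * l1_norm (X k - x)) \<longlonglongrightarrow> 0 + c * 0"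
    by (intro tendsto_intros LIMSEQ_Suc dist)
  ultimately have "l1_norm (x - f x) \<le> 0"
    by (intro LIMSEQ_le_const[where X = "\<lambda>k. l1_norm (X (Suc k) - x) + c * l1_norm (X k - x)"])
      auto
  with l1_norm_nonneg[of "x - f x"] have "x = f x"
    using l1_norm_diff_eq_0_iff[OF xc fxc] by linarith
  with x show ?thesis by metis
qed

section \<open>Stochastic matrices\<close>

lemma mult_mat_vec_index:
  assumes "A \<in> carrier_mat nr nc" "x \<in> carrier_vec nc" "i < nr"
  shows "(A *\<^sub>v x) $ i = (\<Sum>j<nc. A $$ (i, j) * x $ j)"
  using assms by (auto simp: scalar_prod_def atLeast0LessThan intro!: sum.cong)

lemma stochastic_mat_iff:
  "stochastic_mat nr nc A \<longleftrightarrow> A \<in> carrier_mat nr nc \<and>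
     (\<forall>i<nr. \<forall>j<nc. 0 \<le> A $$ (i, j)) \<and> (\<forall>j<nc. (\<Sum>i<nr. A $$ (i, j)) = 1)"
  by (auto simp: stochastic_mat_def stochastic_vec_def)

lemma stochastic_mat_carrier: "stochastic_mat nr nc A \<Longrightarrow> A \<in> carrier_mat nr nc"
  by (simp add: stochastic_mat_def)

lemma stochastic_mat_mult_vec:
  assumes A: "stochastic_mat nr nc A" and x: "stochastic_vec nc x"
  shows "stochastic_vec nr (A *\<^sub>v x)"
proof -
  note Ac = stochastic_mat_carrier[OF A] and xc = stochastic_vec_carrier[OF x]
  have "(\<Sum>i<nr. \<Sum>j<nc. A $$ (i, j) * x $ j) = (\<Sum>j<nc. (\<Sum>i<nr. A $$ (i, j)) * x $ j)"
    by (subst sum.swap) (simp add: sum_distrib_right)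
  also have "\<dots> = 1" using A x by (simp add: stochastic_mat_iff stochastic_vec_def)
  finally show ?thesis using A x Ac
    by (auto simp: stochastic_vec_def stochastic_mat_iff mult_mat_vec_index[OF Ac xc]
        simp del: index_mult_mat_vec intro!: sum_nonneg)
qed

lemma l1_norm_stochastic_mat_mult_vec_le:
  assumes A: "stochastic_mat nr nc A" and x: "x \<in> carrier_vec nc"
  shows "l1_norm (A *\<^sub>v x) \<le> l1_norm x"
proof -
  note Ac = stochastic_mat_carrier[OF A]
  have "l1_norm (A *\<^sub>v x) = (\<Sum>i<nr. \<bar>\<Sum>j<nc. A $$ (i, j) * x $ j\<bar>)"
    using Ac unfolding l1_norm_def
    by (auto simp: mult_mat_vec_index[OF Ac x] simp del: index_mult_mat_vec)
  also have "\<dots> \<le> (\<Sum>i<nr. \<Sum>j<nc. A $$ (i, j) * \<bar>x $ j\<bar>)"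
    using A by (intro sum_mono order.trans[OF sum_abs]) (auto simp: stochastic_mat_iff abs_mult)
  also have "\<dots> = (\<Sum>j<nc. (\<Sum>i<nr. A $$ (i, j)) * \<bar>x $ j\<bar>)"
    by (subst sum.swap) (simp add: sum_distrib_right)
  also have "\<dots> = l1_norm x" using A x by (simp add: stochastic_mat_iff l1_norm_def)
  finally show ?thesis .
qed

lemma l1_norm_stochastic_mat_diff_le:
  assumes A: "stochastic_mat nr nc A" and x: "x \<in> carrier_vec nc" and y: "y \<in> carrier_vec nc"
  shows "l1_norm (A *\<^sub>v x - A *\<^sub>v y) \<le> l1_norm (x - y)"
  using l1_norm_stochastic_mat_mult_vec_le[OF A, of "x - y"] x y
  by (simp add: mult_minus_distrib_mat_vec[OF stochastic_mat_carrier[OF A] x y])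

lemma stochastic_mat_mult:
  assumes A: "stochastic_mat nr k A" and B: "stochastic_mat k nc B"
  shows "stochastic_mat nr nc (A * B)"
  unfolding stochastic_mat_def
proof (intro conjI allI impI)
  fix j assume j: "j < nc"
  have "col (A * B) j = A *\<^sub>v col B j"
    using stochastic_mat_carrier[OF A] stochastic_mat_carrier[OF B] j by (rule col_mult2)
  with j B show "stochastic_vec nr (col (A * B) j)"
    using stochastic_mat_mult_vec[OF A] by (simp add: stochastic_mat_def)
qed (use stochastic_mat_carrier[OF A] stochastic_mat_carrier[OF B] in simp)

lemma stochastic_mat_one: "stochastic_mat n n (1\<^sub>m n)"
  by (auto simp: stochastic_mat_iff)

lemma stochastic_mat_col_mat: "stochastic_vec n x \<Longrightarrow> stochastic_mat n 1 (col_mat x)"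
  using stochastic_vec_carrier[of n x] by (auto simp: stochastic_mat_def col_mat_of_cols)

text \<open>The entries of a column of \<open>R\<close> are those of a fibre of the tensor along its first index,
  because base-\<open>n\<close> digits are admissible indices; \<open>n > 0\<close> is what makes them smaller than \<open>n\<close>.\<close>

lemma stochastic_mat_flattening:
  assumes P: "stochastic_tensor m n P" and n: "0 < n" and m: "0 < m"
  shows "stochastic_mat n (n ^ (m - 1)) (flattening m n P)"
proof -
  have digits: "length (map (\<lambda>t. j div n ^ t mod n) [0..<m - 1]) = m - 1 \<and>
      set (map (\<lambda>t. j div n ^ t mod n) [0..<m - 1]) \<subseteq> {..<n}" for j
    using n by auto
  have "0 \<le> P (i # map (\<lambda>t. j div n ^ t mod n) [0..<m - 1])" if "i < n" for i j
    using P digits[of j] m that unfolding stochastic_tensor_def by simp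
  moreover have "(\<Sum>i<n. P (i # map (\<lambda>t. j div n ^ t mod n) [0..<m - 1])) = 1" for j
    using P digits[of j] unfolding stochastic_tensor_def by blast
  ultimately show ?thesis by (auto simp: stochastic_mat_iff flattening_def)
qed

section \<open>Kronecker products\<close>

text \<open>The row number of a Kronecker product encodes a pair of row numbers by division with
  remainder, so column sums become double sums and factorise.\<close>

lemma sum_div_mod:
  fixes F :: "nat \<Rightarrow> nat \<Rightarrow> 'a :: comm_monoid_add"
  shows "(\<Sum>i<a * b. F (i div b) (i mod b)) = (\<Sum>p<a. \<Sum>q<b. F p q)"
proof -
  have "(\<Sum>i\<in>{p * b..<p * b + b}. F (i div b) (i mod b)) = (\<Sum>q<b. F p q)" for p
    using sum.shift_bounds_nat_ivl[of "\<lambda>i. F (i div b) (i mod b)" 0 "p * b" b]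
    by (auto simp: atLeast0LessThan add.commute intro!: sum.cong)
  then show ?thesis
    using sum.nat_group[of "\<lambda>i. F (i div b) (i mod b)" b a] by simp
qed

lemma kron_dim [simp]:
  "dim_row (kron A B) = dim_row A * dim_row B" "dim_col (kron A B) = dim_col A * dim_col B"
  by (auto simp: kron_def)

lemma kron_index:
  "i < dim_row A * dim_row B \<Longrightarrow> j < dim_col A * dim_col B \<Longrightarrow>
   kron A B $$ (i, j) =
     A $$ (i div dim_row B, j div dim_col B) * B $$ (i mod dim_row B, j mod dim_col B)"
  by (simp add: kron_def)

lemma mod_less_factor: "i < a * b \<Longrightarrow> i mod b < (b :: nat)"
  by (metis mod_less_divisor mult_0_right not_gr_zero not_less_zero)

lemma stochastic_mat_kron:
  assumes A: "stochastic_mat a c A" and B: "stochastic_mat b d B"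
  shows "stochastic_mat (a * b) (c * d) (kron A B)"
proof -
  have [simp]: "dim_row A = a" "dim_col A = c" "dim_row B = b" "dim_col B = d"
    using A B by (auto simp: stochastic_mat_def)
  have "(\<Sum>i<a * b. kron A B $$ (i, j)) = 1" if j: "j < c * d" for j
  proof -
    have "(\<Sum>i<a * b. kron A B $$ (i, j)) =
        (\<Sum>i<a * b. A $$ (i div b, j div d) * B $$ (i mod b, j mod d))"
      using j by (intro sum.cong) (auto simp: kron_index)
    also have "\<dots> = (\<Sum>p<a. A $$ (p, j div d)) * (\<Sum>q<b. B $$ (q, j mod d))"
      by (simp add: sum_div_mod[of "\<lambda>p q. A $$ (p, j div d) * B $$ (q, j mod d)"] sum_product)
    also have "\<dots> = 1"
      using A B j by (simp add: stochastic_mat_iff less_mult_imp_div_less mod_less_factor)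
    finally show ?thesis .
  qed
  moreover have "0 \<le> kron A B $$ (i, j)" if "i < a * b" "j < c * d" for i j
    using A B that
    by (simp add: kron_index stochastic_mat_iff less_mult_imp_div_less mod_less_factor)
  ultimately show ?thesis by (auto simp: stochastic_mat_iff)
qed

lemma kron_list_simps [simp]:
  "kron_list [] = 1\<^sub>m 1" "kron_list (A # As) = kron A (kron_list As)"
  by (auto simp: kron_list_def)

lemma stochastic_mat_kron_list:
  assumes "\<forall>A\<in>set As. stochastic_mat (dim_row A) (dim_col A) A"
  shows "stochastic_mat (\<Prod>A\<leftarrow>As. dim_row A) (\<Prod>A\<leftarrow>As. dim_col A) (kron_list As)"
  using assms by (induction As) (auto simp: stochastic_mat_one intro: stochastic_mat_kron)

lemma kron_single_col_mult:
  assumes "dim_col A = 1" "dim_col B = dim_row C"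
  shows "kron A B * C = kron A (B * C)"
  using assms
  by (intro eq_matI)
    (auto simp: kron_index scalar_prod_def sum_distrib_left mult.assoc mod_less_factor
      less_mult_imp_div_less intro!: sum.cong)

lemma kron_mult_single_col:
  fixes A :: "'a :: comm_semiring_1 mat"
  assumes "dim_col B = 1" "dim_col A = dim_row C"
  shows "kron A B * C = kron (A * C) B"
  using assms
  by (intro eq_matI)
    (auto simp: kron_index scalar_prod_def sum_distrib_left mult_ac mod_less_factor
      less_mult_imp_div_less intro!: sum.cong)

lemma dim_kron_list [simp]:
  "dim_row (kron_list As) = (\<Prod>A\<leftarrow>As. dim_row A)"
  "dim_col (kron_list As) = (\<Prod>A\<leftarrow>As. dim_col A)"
  by (induction As) auto

lemma prod_list_eq_1: "(\<forall>x\<in>set xs. f x = 1) \<Longrightarrow> prod_list (map f xs) = (1 :: 'a :: monoid_mult)"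
  by (induction xs) auto

text \<open>Single-column factors are vectors, so multiplying by the one square factor inserts the
  argument in its slot; this is what turns the matrix \<open>S(y)\<close> into a multilinear form.\<close>

lemma kron_list_slot_mult:
  fixes C :: "'a :: comm_semiring_1 mat"
  assumes "\<forall>A\<in>set As \<union> set Bs. dim_col A = 1" "dim_row C = n"
  shows "kron_list (As @ [1\<^sub>m n] @ Bs) * C = kron_list (As @ [C] @ Bs)"
  using assms
proof (induction As)
  case Nil
  then have "dim_col (kron_list Bs) = 1" by (simp add: prod_list_eq_1)
  with Nil show ?case by (simp add: kron_mult_single_col)
next
  case (Cons A As)
  have "(\<Prod>A\<leftarrow>As. dim_col A) = 1" "(\<Prod>A\<leftarrow>Bs. dim_col A) = 1"
    using Cons.prems by (intro prod_list_eq_1; simp)+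
  with Cons show ?case by (simp add: kron_single_col_mult)
qed

text \<open>Kronecker products are matrices even when all factors are vectors; this is the
  $1$-norm distance of single-column matrices.\<close>

definition col_dist :: "real mat \<Rightarrow> real mat \<Rightarrow> real" where
  "col_dist A B = l1_norm (col A 0 - col B 0)"

lemma col_dist_eq:
  "A \<in> carrier_mat n 1 \<Longrightarrow> B \<in> carrier_mat n 1 \<Longrightarrow>
    col_dist A B = (\<Sum>i<n. \<bar>A $$ (i, 0) - B $$ (i, 0)\<bar>)"
  unfolding col_dist_def by (subst l1_norm_diff[of _ n]) auto

lemma col_dist_col_mat [simp]:
  "col_dist (col_mat x) (col_mat y) = l1_norm (x - y)"
  by (simp add: col_dist_def)

lemma col_dist_same [simp]: "col_dist A A = 0"
  by (simp add: col_dist_def l1_norm_def)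

text \<open>Write \<open>A \<otimes> B - A' \<otimes> B' = (A - A') \<otimes> B + A' \<otimes> (B - B')\<close>. The $1$-norm of a Kronecker product
  of vectors is the product of the $1$-norms, and \<open>B\<close> and \<open>A'\<close> have norm one.\<close>

lemma col_dist_kron_le:
  assumes A: "stochastic_mat a 1 A" "stochastic_mat a 1 A'"
    and B: "stochastic_mat b 1 B" "stochastic_mat b 1 B'"
  shows "col_dist (kron A B) (kron A' B') \<le> col_dist A A' + col_dist B B'"
proof -
  note c = A[THEN stochastic_mat_carrier] B[THEN stochastic_mat_carrier]
  have [simp]: "dim_row A = a" "dim_row A' = a" "dim_row B = b" "dim_row B' = b"
    "dim_col A = 1" "dim_col A' = 1" "dim_col B = 1" "dim_col B' = 1" using c by auto
  have k: "kron A B \<in> carrier_mat (a * b) 1" "kron A' B' \<in> carrier_mat (a * b) 1" by auto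
  let ?e = "\<lambda>p q. \<bar>A $$ (p, 0) * B $$ (q, 0) - A' $$ (p, 0) * B' $$ (q, 0)\<bar>"
  have "col_dist (kron A B) (kron A' B') = (\<Sum>i<a * b. ?e (i div b) (i mod b))"
    unfolding col_dist_eq[OF k] by (intro sum.cong) (auto simp: kron_index)
  also have "\<dots> = (\<Sum>p<a. \<Sum>q<b. ?e p q)" by (rule sum_div_mod)
  also have "\<dots> \<le> (\<Sum>p<a. \<Sum>q<b. \<bar>A $$ (p, 0) - A' $$ (p, 0)\<bar> * B $$ (q, 0)
      + A' $$ (p, 0) * \<bar>B $$ (q, 0) - B' $$ (q, 0)\<bar>)"
  proof (intro sum_mono)
    fix p q assume "p \<in> {..<a}" "q \<in> {..<b}"
    then have nn: "0 \<le> B $$ (q, 0)" "0 \<le> A' $$ (p, 0)"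
      using A B by (auto simp: stochastic_mat_iff)
    have "?e p q = \<bar>(A $$ (p, 0) - A' $$ (p, 0)) * B $$ (q, 0)
        + A' $$ (p, 0) * (B $$ (q, 0) - B' $$ (q, 0))\<bar>"
      by (simp add: algebra_simps)
    also have "\<dots> \<le> \<bar>(A $$ (p, 0) - A' $$ (p, 0)) * B $$ (q, 0)\<bar>
        + \<bar>A' $$ (p, 0) * (B $$ (q, 0) - B' $$ (q, 0))\<bar>" by (rule abs_triangle_ineq)
    finally show "?e p q \<le> \<bar>A $$ (p, 0) - A' $$ (p, 0)\<bar> * B $$ (q, 0)
        + A' $$ (p, 0) * \<bar>B $$ (q, 0) - B' $$ (q, 0)\<bar>"
      using nn by (simp add: abs_mult)
  qed
  also have "\<dots> = (\<Sum>p<a. \<bar>A $$ (p, 0) - A' $$ (p, 0)\<bar>) * (\<Sum>q<b. B $$ (q, 0))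
      + (\<Sum>p<a. A' $$ (p, 0)) * (\<Sum>q<b. \<bar>B $$ (q, 0) - B' $$ (q, 0)\<bar>)"
    by (simp add: sum.distrib sum_product)
  also have "\<dots> = col_dist A A' + col_dist B B'"
    using A B by (simp add: col_dist_eq[OF c(1,2)] col_dist_eq[OF c(3,4)] stochastic_mat_iff)
  finally show ?thesis .
qed

text \<open>A Kronecker product of stochastic vectors is $1$-Lipschitz in each factor, because all the
  other factors have norm one. Stochasticity of the products is part of the conclusion because
  the induction needs it for the tails.\<close>

lemma col_dist_kron_list_le:
  assumes "list_all2 (\<lambda>A B. stochastic_mat n 1 A \<and> stochastic_mat n 1 B) As Bs"
  shows "stochastic_mat (n ^ length As) 1 (kron_list As) \<and>
    stochastic_mat (n ^ length As) 1 (kron_list Bs) \<and>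
    col_dist (kron_list As) (kron_list Bs) \<le> (\<Sum>(A, B)\<leftarrow>zip As Bs. col_dist A B)"
  using assms
proof (induction rule: list_all2_induct)
  case Nil
  show ?case by (simp add: stochastic_mat_one)
next
  case (Cons A As B Bs)
  let ?N = "n ^ length As"
  have s: "stochastic_mat n 1 A" "stochastic_mat n 1 B"
    "stochastic_mat ?N 1 (kron_list As)" "stochastic_mat ?N 1 (kron_list Bs)"
    using Cons by auto
  have "col_dist (kron A (kron_list As)) (kron B (kron_list Bs))
      \<le> col_dist A B + col_dist (kron_list As) (kron_list Bs)"
    by (rule col_dist_kron_le[OF s])
  moreover have "stochastic_mat (n * ?N) (1 * 1) (kron A (kron_list As))"
    "stochastic_mat (n * ?N) (1 * 1) (kron B (kron_list Bs))"
    using s by (intro stochastic_mat_kron; simp)+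
  ultimately show ?case using Cons by simp
qed

section \<open>The averaged slot matrix\<close>

lemma finsum_mat_index:
  fixes f :: "'b \<Rightarrow> 'a :: comm_ring_1 mat"
  assumes "finite L" "\<forall>l\<in>L. f l \<in> carrier_mat nr nc"
  shows "finsum (module_mat TYPE('a) nr nc) f L =
    mat nr nc (\<lambda>(i, j). \<Sum>l\<in>L. f l $$ (i, j))"
proof -
  interpret abelian_group "module_mat TYPE('a) nr nc" by (rule abelian_group_mat)
  show ?thesis using assms
  proof (induction L rule: finite_induct)
    case empty
    show ?case by (auto simp: module_mat_simps)
  next
    case (insert l L)
    then show ?case by (subst finsum_insert) (auto simp: module_mat_simps intro!: eq_matI)
  qed
qed

text \<open>The matrix \<open>S(x)\<close> is \<open>R\<close> times the average, over the slots \<open>l\<close>, of the Kronecker products with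
  the identity in slot \<open>l\<close>. Averaging before applying \<open>R\<close> exhibits \<open>S(x)\<close> as a product of two
  stochastic matrices, and lets one estimate for \<open>R\<close> cover all slots.\<close>

definition slot_mat :: "nat \<Rightarrow> nat \<Rightarrow> real vec \<Rightarrow> nat \<Rightarrow> real mat" where
  "slot_mat m n x l =
     kron_list (replicate (l - 1) (col_mat x) @ [1\<^sub>m n] @ replicate (m - 1 - l) (col_mat x))"

definition mean_slot_mat :: "nat \<Rightarrow> nat \<Rightarrow> real vec \<Rightarrow> real mat" where
  "mean_slot_mat m n x =
     mat (n ^ (m - 1)) n (\<lambda>(i, j). (\<Sum>l = 1..m - 1. slot_mat m n x l $$ (i, j)) / (real m - 1))"

definition vec_power :: "nat \<Rightarrow> real vec \<Rightarrow> real vec" where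
  "vec_power p x = col (kron_list (replicate p (col_mat x))) 0"

lemma stochastic_slot_mat:
  assumes x: "stochastic_vec n x" and l: "l \<in> {1..m - 1}"
  shows "stochastic_mat (n ^ (m - 1)) n (slot_mat m n x l)"
proof -
  let ?As = "replicate (l - 1) (col_mat x) @ [1\<^sub>m n] @ replicate (m - 1 - l) (col_mat x)"
  have [simp]: "dim_vec x = n" using stochastic_vec_carrier[OF x] by simp
  have "stochastic_mat (\<Prod>A\<leftarrow>?As. dim_row A) (\<Prod>A\<leftarrow>?As. dim_col A) (slot_mat m n x l)"
    unfolding slot_mat_def
    using stochastic_mat_col_mat[OF x] stochastic_mat_one[of n]
    by (intro stochastic_mat_kron_list) auto
  moreover have "m - 1 = (l - 1) + 1 + (m - 1 - l)" using l by auto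
  then have "(\<Prod>A\<leftarrow>?As. dim_row A) = n ^ (m - 1)"
    by (metis (no_types, lifting) add.assoc dim_row_mat(1) index_one_mat(2) list.simps(8,9) map_append
        map_replicate mat_of_cols_carrier(2) power_add power_one_right prod_list.Cons prod_list.Nil
        prod_list.append prod_list_replicate mult_1_right \<open>dim_vec x = n\<close>)
  moreover have "(\<Prod>A\<leftarrow>?As. dim_col A) = n" by simp
  ultimately show ?thesis by simp
qed

lemma stochastic_vec_power:
  assumes x: "stochastic_vec n x"
  shows "stochastic_vec (n ^ p) (vec_power p x)"
proof -
  have "stochastic_mat (n ^ p) 1 (kron_list (replicate p (col_mat x)))"
    using col_dist_kron_list_le[of n "replicate p (col_mat x)" "replicate p (col_mat x)"]
      stochastic_mat_col_mat[OF x] by (simp add: list_all2_conv_all_nth)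
  then show ?thesis by (simp add: stochastic_mat_def vec_power_def)
qed

lemma vec_power_lipschitz:
  assumes x: "stochastic_vec n x" and y: "stochastic_vec n y"
  shows "l1_norm (vec_power p x - vec_power p y) \<le> real p * l1_norm (x - y)"
  using col_dist_kron_list_le[of n "replicate p (col_mat x)" "replicate p (col_mat y)"]
    stochastic_mat_col_mat[OF x] stochastic_mat_col_mat[OF y]
  by (simp add: list_all2_conv_all_nth zip_replicate sum_list_replicate vec_power_def
      flip: col_dist_def)

text \<open>Filling the open slot with \<open>x\<close> itself leaves only \<open>m - 2\<close> of the \<open>m - 1\<close> factors different
  from those of the Kronecker power of \<open>x\<close>. This is where the inverse iteration gains over
  plain fixed-point iteration.\<close>

lemma slot_mat_mult_vec_power_le:
  assumes x: "stochastic_vec n x" and y: "stochastic_vec n y" and l: "l \<in> {1..m - 1}"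
  shows "l1_norm (slot_mat m n y l *\<^sub>v x - vec_power (m - 1) x)
    \<le> (real m - 2) * l1_norm (y - x)"
proof -
  let ?X = "col_mat x" and ?Y = "col_mat y"
  let ?As = "replicate (l - 1) ?Y @ [?X] @ replicate (m - 1 - l) ?Y"
  let ?Bs = "replicate (l - 1) ?X @ [?X] @ replicate (m - 1 - l) ?X"
  have xc: "x \<in> carrier_vec n" by (rule stochastic_vec_carrier[OF x])
  have [simp]: "dim_vec x = n" "dim_vec y = n"
    using stochastic_vec_carrier[OF x] stochastic_vec_carrier[OF y] by simp_all
  have "slot_mat m n y l * ?X = kron_list ?As"
    unfolding slot_mat_def by (intro kron_list_slot_mult) auto
  moreover have "col (slot_mat m n y l * ?X) 0 = slot_mat m n y l *\<^sub>v col ?X 0"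
    using stochastic_mat_carrier[OF stochastic_slot_mat[OF y l]] by (rule col_mult2) auto
  moreover have "col ?X 0 = x" using xc by (subst col_mat_of_cols) auto
  ultimately have 1: "slot_mat m n y l *\<^sub>v x = col (kron_list ?As) 0" by simp
  have "m - 1 = (l - 1) + Suc (m - 1 - l)" using l by auto
  then have "replicate (m - 1) ?X = ?Bs"
    by (metis append_Cons append_Nil replicate_Suc replicate_add)
  then have 2: "vec_power (m - 1) x = col (kron_list ?Bs) 0" by (simp add: vec_power_def)
  have "list_all2 (\<lambda>A B. stochastic_mat n 1 A \<and> stochastic_mat n 1 B) ?As ?Bs"
    using stochastic_mat_col_mat[OF x] stochastic_mat_col_mat[OF y]
    by (intro list_all2_appendI) (auto simp: list_all2_conv_all_nth)
  from col_dist_kron_list_le[OF this]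
  have "col_dist (kron_list ?As) (kron_list ?Bs) \<le> (\<Sum>(A, B)\<leftarrow>zip ?As ?Bs. col_dist A B)"
    by blast
  also have "\<dots> = (real (l - 1) + real (m - 1 - l)) * col_dist ?Y ?X"
    by (simp add: zip_replicate sum_list_replicate algebra_simps)
  also have "col_dist ?Y ?X = l1_norm (y - x)" by (rule col_dist_col_mat)
  also have "real (l - 1) + real (m - 1 - l) = real m - 2" using l by auto
  finally show ?thesis unfolding 1 2 col_dist_def .
qed

lemma S_mat_eq:
  assumes x: "stochastic_vec n x"
  shows "S_mat m n P x = flattening m n P * mean_slot_mat m n x"
proof -
  let ?T = "finsum (module_mat TYPE(real) (n ^ (m - 1)) n) (slot_mat m n x) {1..m - 1}"
  have T: "?T = mat (n ^ (m - 1)) n (\<lambda>(i, j). \<Sum>l = 1..m - 1. slot_mat m n x l $$ (i, j))"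
    using stochastic_mat_carrier[OF stochastic_slot_mat[OF x]] by (intro finsum_mat_index) auto
  have R: "flattening m n P \<in> carrier_mat n (n ^ (m - 1))" by (simp add: flattening_def)
  have "S_mat m n P x = (1 / (real m - 1)) \<cdot>\<^sub>m (flattening m n P * ?T)"
    by (simp add: S_mat_def slot_mat_def[abs_def])
  also have "\<dots> = flattening m n P * ((1 / (real m - 1)) \<cdot>\<^sub>m ?T)"
    by (rule mult_smult_distrib[OF R, of _ n, symmetric]) (unfold T, simp)
  also have "(1 / (real m - 1)) \<cdot>\<^sub>m ?T = mean_slot_mat m n x"
    unfolding T mean_slot_mat_def by (intro eq_matI) auto
  finally show ?thesis .
qed

lemma stochastic_mean_slot_mat:
  assumes x: "stochastic_vec n x" and m: "2 \<le> m"
  shows "stochastic_mat (n ^ (m - 1)) n (mean_slot_mat m n x)"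
  unfolding stochastic_mat_iff
proof (intro conjI allI impI)
  note s = stochastic_slot_mat[OF x, of _ m, unfolded stochastic_mat_iff]
  fix j assume j: "j < n"
  show "0 \<le> mean_slot_mat m n x $$ (i, j)" if "i < n ^ (m - 1)" for i
    using s j that m by (auto simp: mean_slot_mat_def intro!: divide_nonneg_nonneg sum_nonneg)
  have "(\<Sum>i<n ^ (m - 1). mean_slot_mat m n x $$ (i, j)) =
      (\<Sum>l = 1..m - 1. \<Sum>i<n ^ (m - 1). slot_mat m n x l $$ (i, j)) / (real m - 1)"
    using j by (subst sum.swap) (simp add: mean_slot_mat_def sum_divide_distrib)
  also have "\<dots> = (\<Sum>l = 1..m - 1. 1) / (real m - 1)" using s j by simp
  also have "\<dots> = 1" using m by (simp add: of_nat_diff)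
  finally show "(\<Sum>i<n ^ (m - 1). mean_slot_mat m n x $$ (i, j)) = 1" .
qed (simp add: mean_slot_mat_def)

lemma mean_slot_mat_mult_vec_power_le:
  assumes x: "stochastic_vec n x" and y: "stochastic_vec n y" and m: "2 \<le> m"
  shows "l1_norm (mean_slot_mat m n y *\<^sub>v x - vec_power (m - 1) x)
    \<le> (real m - 2) * l1_norm (y - x)"
proof -
  let ?N = "n ^ (m - 1)" and ?w = "vec_power (m - 1) x"
  let ?r = "\<lambda>l. slot_mat m n y l *\<^sub>v x - ?w"
  have xc: "x \<in> carrier_vec n" and wc: "?w \<in> carrier_vec ?N"
    using x stochastic_vec_power[OF x] by (auto intro: stochastic_vec_carrier)
  note Kc = stochastic_mat_carrier[OF stochastic_slot_mat[OF y]]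
  note Mc = stochastic_mat_carrier[OF stochastic_mean_slot_mat[OF y m]]
  have m0: "real m - 1 > 0" using m by simp
  have entry: "(mean_slot_mat m n y *\<^sub>v x) $ i - ?w $ i =
      (\<Sum>l = 1..m - 1. (slot_mat m n y l *\<^sub>v x) $ i - ?w $ i) / (real m - 1)"
    if i: "i < ?N" for i
  proof -
    have "(mean_slot_mat m n y *\<^sub>v x) $ i =
        (\<Sum>j<n. \<Sum>l = 1..m - 1. slot_mat m n y l $$ (i, j) * x $ j) / (real m - 1)"
      unfolding mult_mat_vec_index[OF Mc xc i] using i
      by (simp add: mean_slot_mat_def sum_divide_distrib sum_distrib_right)
    also have "\<dots> = (\<Sum>l = 1..m - 1. (slot_mat m n y l *\<^sub>v x) $ i) / (real m - 1)"
      by (subst sum.swap) (simp add: mult_mat_vec_index[OF Kc xc i] del: index_mult_mat_vec)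
    finally show ?thesis using m0 m
      by (simp add: sum_subtractf diff_divide_distrib of_nat_diff del: index_mult_mat_vec)
  qed
  have "l1_norm (mean_slot_mat m n y *\<^sub>v x - ?w) =
      (\<Sum>i<?N. \<bar>\<Sum>l = 1..m - 1. (slot_mat m n y l *\<^sub>v x) $ i - ?w $ i\<bar>) / (real m - 1)"
    unfolding l1_norm_diff[OF wc] sum_divide_distrib
    using m0 by (intro sum.cong) (simp_all add: entry abs_divide del: index_mult_mat_vec One_nat_def)
  also have "\<dots> \<le> (\<Sum>i<?N. \<Sum>l = 1..m - 1. \<bar>(slot_mat m n y l *\<^sub>v x) $ i - ?w $ i\<bar>)
      / (real m - 1)"
    using m0 by (intro divide_right_mono sum_mono sum_abs) auto
  also have "\<dots> = (\<Sum>l = 1..m - 1. l1_norm (?r l)) / (real m - 1)"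
    by (subst sum.swap) (simp add: l1_norm_diff[OF wc] del: index_mult_mat_vec One_nat_def)
  also have "\<dots> \<le> (\<Sum>l = 1..m - 1. (real m - 2) * l1_norm (y - x)) / (real m - 1)"
    using m0 by (intro divide_right_mono sum_mono slot_mat_mult_vec_power_le[OF x y]) auto
  also have "\<dots> = (real m - 2) * l1_norm (y - x)" using m0 m by (simp add: of_nat_diff)
  finally show ?thesis .
qed

lemma stochastic_S_mat:
  assumes "stochastic_tensor m n P" "stochastic_vec n x" "2 \<le> m" "0 < n"
  shows "stochastic_mat n n (S_mat m n P x)"
  unfolding S_mat_eq[OF assms(2)]
  using assms
  by (intro stochastic_mat_mult[where k = "n ^ (m - 1)"] stochastic_mat_flattening
      stochastic_mean_slot_mat) auto

text \<open>Both vectors are images under \<open>R\<close>, which is stochastic, so the slotwise estimate carries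
  over. At \<open>y = x\<close> the bound says \<open>S(x) x = R(x \<otimes> \<dots> \<otimes> x)\<close>.\<close>

lemma S_mat_mult_flattening_le:
  assumes P: "stochastic_tensor m n P" and x: "stochastic_vec n x" and y: "stochastic_vec n y"
    and m: "2 \<le> m" and n: "0 < n"
  shows "l1_norm (S_mat m n P y *\<^sub>v x - flattening m n P *\<^sub>v vec_power (m - 1) x)
    \<le> (real m - 2) * l1_norm (y - x)"
proof -
  have R: "stochastic_mat n (n ^ (m - 1)) (flattening m n P)"
    using P n m by (intro stochastic_mat_flattening) auto
  note Mc = stochastic_mat_carrier[OF stochastic_mean_slot_mat[OF y m]]
  have xc: "x \<in> carrier_vec n" by (rule stochastic_vec_carrier[OF x])
  have "S_mat m n P y *\<^sub>v x = flattening m n P *\<^sub>v (mean_slot_mat m n y *\<^sub>v x)"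
    unfolding S_mat_eq[OF y] using stochastic_mat_carrier[OF R] Mc xc
    by (rule assoc_mult_mat_vec)
  moreover have "mean_slot_mat m n y *\<^sub>v x \<in> carrier_vec (n ^ (m - 1))"
    using Mc xc by simp
  ultimately show ?thesis
    using l1_norm_stochastic_mat_diff_le[OF R, of "mean_slot_mat m n y *\<^sub>v x"
        "vec_power (m - 1) x"] stochastic_vec_carrier[OF stochastic_vec_power[OF x]]
      mean_slot_mat_mult_vec_power_le[OF x y m] by fastforce
qed

section \<open>The solution and the inverse iteration\<close>

lemma zero_of_self_bounded: "0 \<le> d \<Longrightarrow> d \<le> c * d \<Longrightarrow> c < 1 \<Longrightarrow> d = (0 :: real)"
  using mult_strict_right_mono[of c 1 d] by (cases "d = 0") auto

locale multilinear_pagerank =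
  fixes m n :: nat and \<alpha> :: real and P :: "nat list \<Rightarrow> real" and v :: "real vec"
  assumes m: "2 \<le> m" and P: "stochastic_tensor m n P" and v: "stochastic_vec n v"
    and \<alpha>_nonneg: "0 \<le> \<alpha>" and \<alpha>_less: "\<alpha> < 1 / (real m - 1)"
begin

lemma n_pos: "0 < n"
  using v by (cases n) (auto simp: stochastic_vec_def)

lemma \<alpha>_mult_less_1: "\<alpha> * (real m - 1) < 1"
  using \<alpha>_less m by (simp add: field_simps)

lemma \<alpha>_less_1: "\<alpha> < 1"
proof -
  have "\<alpha> * 1 \<le> \<alpha> * (real m - 1)" using \<alpha>_nonneg m by (intro mult_left_mono) auto
  with \<alpha>_mult_less_1 show ?thesis by simp
qed

lemmas v_carrier = stochastic_vec_carrier[OF v]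

lemma stochastic_R: "stochastic_mat n (n ^ (m - 1)) (flattening m n P)"
  using P n_pos m by (intro stochastic_mat_flattening) auto

lemma stochastic_S: "stochastic_vec n y \<Longrightarrow> stochastic_mat n n (S_mat m n P y)"
  using stochastic_S_mat[OF P _ m n_pos] .

definition damped :: "real vec \<Rightarrow> real vec" where
  "damped w = \<alpha> \<cdot>\<^sub>v w + (1 - \<alpha>) \<cdot>\<^sub>v v"

lemma stochastic_damped: "stochastic_vec n w \<Longrightarrow> stochastic_vec n (damped w)"
  unfolding damped_def using v \<alpha>_nonneg \<alpha>_less_1 by (intro stochastic_vec_convex) auto

lemma l1_norm_damped_diff:
  "w \<in> carrier_vec n \<Longrightarrow> w' \<in> carrier_vec n \<Longrightarrow>
   l1_norm (damped w - damped w') = \<alpha> * l1_norm (w - w')"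
  unfolding damped_def using v_carrier \<alpha>_nonneg by (intro l1_norm_affine_diff) auto

definition pagerank_map :: "real vec \<Rightarrow> real vec" where
  "pagerank_map x = damped (flattening m n P *\<^sub>v vec_power (m - 1) x)"

lemma solution_iff:
  "multilinear_pagerank_solution m n \<alpha> P v x \<longleftrightarrow> stochastic_vec n x \<and> x = pagerank_map x"
  by (simp add: multilinear_pagerank_solution_def pagerank_map_def damped_def vec_power_def)

lemma stochastic_flattening_power:
  "stochastic_vec n x \<Longrightarrow> stochastic_vec n (flattening m n P *\<^sub>v vec_power (m - 1) x)"
  by (intro stochastic_mat_mult_vec[OF stochastic_R] stochastic_vec_power)

lemma pagerank_map_contraction:
  assumes x: "stochastic_vec n x" and y: "stochastic_vec n y"
  shows "l1_norm (pagerank_map x - pagerank_map y) \<le> \<alpha> * (real m - 1) * l1_norm (x - y)"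
proof -
  have "l1_norm (pagerank_map x - pagerank_map y) =
      \<alpha> * l1_norm (flattening m n P *\<^sub>v vec_power (m - 1) x
        - flattening m n P *\<^sub>v vec_power (m - 1) y)"
    unfolding pagerank_map_def
    using stochastic_flattening_power[OF x] stochastic_flattening_power[OF y]
    by (intro l1_norm_damped_diff stochastic_vec_carrier)
  also have "\<dots> \<le> \<alpha> * l1_norm (vec_power (m - 1) x - vec_power (m - 1) y)"
    by (intro mult_left_mono l1_norm_stochastic_mat_diff_le[OF stochastic_R]
        stochastic_vec_carrier[OF stochastic_vec_power] x y \<alpha>_nonneg)
  also have "\<dots> \<le> \<alpha> * (real (m - 1) * l1_norm (x - y))"
    by (intro mult_left_mono vec_power_lipschitz[where n = n] x y \<alpha>_nonneg)
  finally show ?thesis using m by (simp add: of_nat_diff mult.assoc)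
qed

lemma unique_solution: "\<exists>!x. multilinear_pagerank_solution m n \<alpha> P v x"
proof -
  have "\<exists>x. stochastic_vec n x \<and> pagerank_map x = x"
  proof (rule stochastic_contraction_fixpoint[OF v _ \<alpha>_mult_less_1])
    show "0 \<le> \<alpha> * (real m - 1)" using \<alpha>_nonneg m by simp
    show "stochastic_vec n (pagerank_map x)" if "stochastic_vec n x" for x
      unfolding pagerank_map_def by (intro stochastic_damped stochastic_flattening_power that)
  qed (rule pagerank_map_contraction)
  moreover have "x = y" if x: "stochastic_vec n x" "x = pagerank_map x"
    and y: "stochastic_vec n y" "y = pagerank_map y" for x y
  proof -
    have "l1_norm (x - y) = 0"
      using pagerank_map_contraction[OF x(1) y(1)] \<alpha>_mult_less_1 l1_norm_nonneg[of "x - y"]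
      by (intro zero_of_self_bounded[where c = "\<alpha> * (real m - 1)"]) (simp_all flip: x(2) y(2))
    then show ?thesis
      using l1_norm_diff_eq_0_iff[OF stochastic_vec_carrier[OF x(1)] stochastic_vec_carrier[OF y(1)]]
      by blast
  qed
  ultimately show ?thesis unfolding solution_iff by metis
qed

definition inverse_step :: "real vec \<Rightarrow> real vec \<Rightarrow> bool" where
  "inverse_step y z \<longleftrightarrow> z \<in> carrier_vec n \<and> z = damped (S_mat m n P y *\<^sub>v z)"

text \<open>For stochastic \<open>y\<close> the map \<open>z \<mapsto> \<alpha> S(y) z + (1 - \<alpha>) v\<close> contracts the whole space by the
  factor \<open>\<alpha>\<close>, which gives uniqueness among all vectors, and it preserves the simplex, which puts
  the fixed point there.\<close>

lemma inverse_step_unique_stochastic: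
  assumes y: "stochastic_vec n y"
  shows "\<exists>z. stochastic_vec n z \<and> (\<forall>z'. inverse_step y z' \<longleftrightarrow> z' = z)"
proof -
  let ?S = "S_mat m n P y"
  note Sc = stochastic_mat_carrier[OF stochastic_S[OF y]]
  have contr: "l1_norm (damped (?S *\<^sub>v z) - damped (?S *\<^sub>v z')) \<le> \<alpha> * l1_norm (z - z')"
    if "z \<in> carrier_vec n" "z' \<in> carrier_vec n" for z z'
    using l1_norm_stochastic_mat_diff_le[OF stochastic_S[OF y] that] that Sc \<alpha>_nonneg
    by (subst l1_norm_damped_diff) (auto intro: mult_left_mono)
  have "\<exists>z. stochastic_vec n z \<and> damped (?S *\<^sub>v z) = z"
    by (rule stochastic_contraction_fixpoint[OF v \<alpha>_nonneg \<alpha>_less_1])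
      (auto intro!: contr stochastic_damped stochastic_mat_mult_vec stochastic_S[OF y]
        intro: stochastic_vec_carrier)
  then obtain z where z: "stochastic_vec n z" "damped (?S *\<^sub>v z) = z" by blast
  note zc = stochastic_vec_carrier[OF z(1)]
  have "z' = z" if z': "inverse_step y z'" for z'
  proof -
    have z'c: "z' \<in> carrier_vec n" and eq: "damped (?S *\<^sub>v z') = z'"
      using z' by (auto simp: inverse_step_def)
    have "l1_norm (z' - z) = 0"
      using contr[OF z'c zc] \<alpha>_less_1 l1_norm_nonneg[of "z' - z"]
      by (intro zero_of_self_bounded[where c = \<alpha>]) (simp_all add: z(2) eq)
    then show ?thesis using zc z'c by (simp add: l1_norm_diff_eq_0_iff)
  qed
  moreover have "inverse_step y z" using z zc by (simp add: inverse_step_def)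
  ultimately show ?thesis using z(1) by blast
qed

text \<open>The length condition on the iterates moves into the step relation; for the start vector it
  follows from stochasticity.\<close>

lemma inverse_iteration_iff:
  assumes "stochastic_vec n x0"
  shows "inverse_iteration m n \<alpha> P v x0 X \<longleftrightarrow> X 0 = x0 \<and> (\<forall>k. inverse_step (X k) (X (Suc k)))"
proof
  assume "inverse_iteration m n \<alpha> P v x0 X"
  then show "X 0 = x0 \<and> (\<forall>k. inverse_step (X k) (X (Suc k)))"
    by (simp add: inverse_iteration_def inverse_step_def damped_def)
next
  assume X: "X 0 = x0 \<and> (\<forall>k. inverse_step (X k) (X (Suc k)))"
  then have "X k \<in> carrier_vec n" for k
    using stochastic_vec_carrier[OF assms] by (cases k) (auto simp: inverse_step_def)
  with X show "inverse_iteration m n \<alpha> P v x0 X"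
    by (simp add: inverse_iteration_def inverse_step_def damped_def)
qed

lemma inverse_iteration_stochastic:
  assumes x0: "stochastic_vec n x0" and X: "inverse_iteration m n \<alpha> P v x0 X"
  shows "stochastic_vec n (X k)"
proof (induction k)
  case 0
  show ?case using x0 X by (simp add: inverse_iteration_def)
next
  case (Suc k)
  then show ?case
    using inverse_step_unique_stochastic[OF Suc] X inverse_iteration_iff[OF x0] by metis
qed

lemma unique_inverse_iteration:
  assumes x0: "stochastic_vec n x0"
  shows "\<exists>!X. inverse_iteration m n \<alpha> P v x0 X"
proof -
  obtain g where g: "stochastic_vec n y \<Longrightarrow> stochastic_vec n (g y)"
    "stochastic_vec n y \<Longrightarrow> inverse_step y z \<longleftrightarrow> z = g y" for y z
    using inverse_step_unique_stochastic by metis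
  define X where "X k = (g ^^ k) x0" for k
  have "stochastic_vec n (X k)" for k by (induction k) (auto simp: X_def x0 g)
  then have "inverse_iteration m n \<alpha> P v x0 X"
    using g unfolding inverse_iteration_iff[OF x0] by (auto simp: X_def)
  moreover have "Y = X" if Y: "inverse_iteration m n \<alpha> P v x0 Y" for Y
  proof
    fix k
    show "Y k = X k"
    proof (induction k)
      case 0
      show ?case using Y by (simp add: X_def inverse_iteration_def)
    next
      case (Suc k)
      have "Y (Suc k) = g (Y k)"
        using Y g(2)[OF inverse_iteration_stochastic[OF x0 Y]] inverse_iteration_iff[OF x0] by blast
      then show ?case using Suc by (simp add: X_def)
    qed
  qed
  ultimately show ?thesis by blast
qed

text \<open>Insert \<open>S(y) x\<close> between \<open>S(y) z\<close> and \<open>R(x \<otimes> \<dots> \<otimes> x)\<close>. The first difference is at most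
  \<open>\<parallel>z - x\<parallel>\<close> and is absorbed on the left, which is the origin of the denominator \<open>1 - \<alpha>\<close>.\<close>

lemma inverse_step_error_le:
  assumes y: "stochastic_vec n y" and z: "inverse_step y z"
    and x: "multilinear_pagerank_solution m n \<alpha> P v x"
  shows "l1_norm (z - x) \<le> (real m - 2) * \<alpha> / (1 - \<alpha>) * l1_norm (y - x)"
proof -
  let ?S = "S_mat m n P y" and ?w = "flattening m n P *\<^sub>v vec_power (m - 1) x"
  have xs: "stochastic_vec n x" and xeq: "x = damped ?w"
    using x by (auto simp: solution_iff pagerank_map_def)
  have zc: "z \<in> carrier_vec n" and zeq: "z = damped (?S *\<^sub>v z)"
    using z by (auto simp: inverse_step_def)
  note S = stochastic_S[OF y] and xc = stochastic_vec_carrier[OF xs]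
  note Sc = stochastic_mat_carrier[OF S]
  have wc: "?w \<in> carrier_vec n" by (rule stochastic_vec_carrier[OF stochastic_flattening_power[OF xs]])
  have "l1_norm (z - x) = l1_norm (damped (?S *\<^sub>v z) - damped ?w)"
    using zeq xeq by simp
  also have "\<dots> = \<alpha> * l1_norm (?S *\<^sub>v z - ?w)"
    using Sc zc wc by (intro l1_norm_damped_diff) auto
  also have "l1_norm (?S *\<^sub>v z - ?w) \<le> l1_norm (?S *\<^sub>v z - ?S *\<^sub>v x) + l1_norm (?S *\<^sub>v x - ?w)"
    using Sc xc wc by (intro l1_norm_triangle[where n = n]) auto
  also have "\<dots> \<le> l1_norm (z - x) + (real m - 2) * l1_norm (y - x)"
    by (intro add_mono l1_norm_stochastic_mat_diff_le[OF S zc xc]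
        S_mat_mult_flattening_le[OF P xs y m n_pos])
  finally have "l1_norm (z - x) \<le> \<alpha> * (l1_norm (z - x) + (real m - 2) * l1_norm (y - x))"
    using \<alpha>_nonneg by (simp add: mult_left_mono)
  then show ?thesis using \<alpha>_less_1 by (simp add: field_simps)
qed

lemma rate_bounds: "0 \<le> (real m - 2) * \<alpha> / (1 - \<alpha>)" "(real m - 2) * \<alpha> / (1 - \<alpha>) < 1"
proof -
  have "0 \<le> real m - 2" using m by simp
  then show "0 \<le> (real m - 2) * \<alpha> / (1 - \<alpha>)" using \<alpha>_nonneg \<alpha>_less_1 by simp
  show "(real m - 2) * \<alpha> / (1 - \<alpha>) < 1"
    using \<alpha>_less_1 \<alpha>_mult_less_1 by (simp add: field_simps)
qed

lemma inverse_iteration_error_le: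
  assumes x0: "stochastic_vec n x0" and X: "inverse_iteration m n \<alpha> P v x0 X"
    and x: "multilinear_pagerank_solution m n \<alpha> P v x"
  shows "l1_norm (X k - x) \<le> ((real m - 2) * \<alpha> / (1 - \<alpha>)) ^ k * l1_norm (x0 - x)"
proof (induction k)
  case 0
  show ?case using X by (simp add: inverse_iteration_def)
next
  case (Suc k)
  have "l1_norm (X (Suc k) - x) \<le> (real m - 2) * \<alpha> / (1 - \<alpha>) * l1_norm (X k - x)"
    using X inverse_iteration_iff[OF x0]
    by (intro inverse_step_error_le[OF inverse_iteration_stochastic[OF x0 X] _ x]) blast
  also have "\<dots> \<le> (real m - 2) * \<alpha> / (1 - \<alpha>) *
      (((real m - 2) * \<alpha> / (1 - \<alpha>)) ^ k * l1_norm (x0 - x))"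
    using Suc rate_bounds(1) by (rule mult_left_mono)
  finally show ?case by (simp only: power_Suc mult.assoc)
qed

lemma inverse_iteration_tendsto:
  assumes x0: "stochastic_vec n x0" and X: "inverse_iteration m n \<alpha> P v x0 X"
    and x: "multilinear_pagerank_solution m n \<alpha> P v x"
  shows "vec_tendsto n X x"
  unfolding vec_tendsto_def
proof (intro allI impI)
  fix i assume i: "i < n"
  let ?b = "\<lambda>k. ((real m - 2) * \<alpha> / (1 - \<alpha>)) ^ k * l1_norm (x0 - x)"
  have xc: "x \<in> carrier_vec n" using x by (auto simp: solution_iff intro: stochastic_vec_carrier)
  have "?b \<longlonglongrightarrow> 0"
    using rate_bounds by (intro tendsto_mult_left_zero LIMSEQ_realpow_zero)
  moreover have "\<bar>X k $ i - x $ i\<bar> \<le> ?b k" for k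
  proof -
    have "\<bar>X k $ i - x $ i\<bar> \<le> l1_norm (X k - x)"
      unfolding l1_norm_diff[OF xc] using i
      by (intro member_le_sum[of i "{..<n}" "\<lambda>i. \<bar>X k $ i - x $ i\<bar>"]) auto
    with inverse_iteration_error_le[OF x0 X x, of k] show ?thesis by simp
  qed
  ultimately have "(\<lambda>k. \<bar>X k $ i - x $ i\<bar>) \<longlonglongrightarrow> 0"
    by - (rule tendsto_sandwich[of "\<lambda>_. 0" _ _ ?b], simp_all)
  then have "(\<lambda>k. X k $ i - x $ i) \<longlonglongrightarrow> 0" by (rule tendsto_rabs_zero_cancel)
  then show "(\<lambda>k. X k $ i) \<longlonglongrightarrow> x $ i" by (simp add: LIM_zero_iff)
qed

end

theorem theorem5p5:
  fixes m n :: nat and P :: "nat list \<Rightarrow> real" and v x0 :: "real vec" and \<alpha> :: real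
  assumes "2 \<le> m"
    and "stochastic_tensor m n P"
    and "stochastic_vec n v"
    and "stochastic_vec n x0"
    and "0 \<le> \<alpha>" and "\<alpha> < 1 / (real m - 1)"
  shows "(\<forall>y. stochastic_vec n y \<longrightarrow> stochastic_mat n n (S_mat m n P y)) \<and>
    (\<exists>!x. multilinear_pagerank_solution m n \<alpha> P v x) \<and>
    (\<exists>!X. inverse_iteration m n \<alpha> P v x0 X) \<and>
    (\<forall>x X. multilinear_pagerank_solution m n \<alpha> P v x \<longrightarrow> inverse_iteration m n \<alpha> P v x0 X \<longrightarrow>
       (\<forall>k. stochastic_vec n (X k)) \<and>
       vec_tendsto n X x \<and>
       (\<forall>k. l1_norm (X k - x) \<le> ((real m - 2) * \<alpha> / (1 - \<alpha>)) ^ k * l1_norm (x0 - x) \<and>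
            ((real m - 2) * \<alpha> / (1 - \<alpha>)) ^ k * l1_norm (x0 - x)
              \<le> 2 * ((real m - 2) * \<alpha> / (1 - \<alpha>)) ^ k))"
proof -
  interpret multilinear_pagerank m n \<alpha> P v
    using assms by unfold_locales
  note x0 = \<open>stochastic_vec n x0\<close>
  have "((real m - 2) * \<alpha> / (1 - \<alpha>)) ^ k * l1_norm (x0 - x)
      \<le> 2 * ((real m - 2) * \<alpha> / (1 - \<alpha>)) ^ k"
    if "multilinear_pagerank_solution m n \<alpha> P v x" for x k
    using mult_left_mono[OF l1_norm_stochastic_diff_le[OF x0, of x]
        zero_le_power[OF rate_bounds(1), of k]] that
    by (simp add: solution_iff mult.commute)
  then show ?thesis
    using stochastic_S unique_solution unique_inverse_iteration[OF x0]
      inverse_iteration_stochastic[OF x0] inverse_iteration_tendsto[OF x0]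
      inverse_iteration_error_le[OF x0]
    by blast
qed

end
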